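(* Let $P_d\ge 1$ be an integer and let $g_0$ be the impulse response of a finite-dimensional causal discrete-time LTI system such that $g_0\in\ell_1$, $g_0(0)>0$, the support of $g_0$ is $\mathbb{Z}_{\ge 0}$, and $g_0$ is strictly monotonically decreasing on its support. Consider the delayed relay feedback system $$u(t)=-\mathcal{C}_{g_0}(\mathrm{sign}(u))(t-P_d),\qquad t\in\mathbb{Z}. \qquad ( * )$$ Then, for any self-oscillation $u$ of $( * )$ that is $P$-periodic with $P\ge P_d$ and satisfies $S_c^-(\Delta_c u^P)=2$ and $S_c^+(u^P)=2$, it must hold that $$2P_d\le P\le 2(P_d+P_s),$$ where $P_s$ is the smallest $t\in\mathbb{Z}_{\ge 0}$ such that $\sum_{k=0}^{t-1}g_0(k)-\sum_{k=t}^{\infty}g_0(k)>0$. In particular, $P=2P_d$ if and only if $$\mathcal{C}_{g_0}(\mathrm{sign}(u))(0)>0,$$ and $\mathrm{sign}(u^{P})=\mathrm{sign}(u^{2P_d})=[\boldsymbol{1}_{P_d}^\top,-\boldsymbol{1}_{P_d}^\top]^\top$.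
   Context: Finite-dimensional causal LTI system: its impulse response $g_0:\mathbb{Z}\to\mathbb{R}$ satisfies $g_0(t)=0$ for $t<0$ and $G_0(z)=\sum_{t\ge 0}g_0(t)z^{-t}$ is rational. $g_0\in\ell_1$ means $\sum_{t}|g_0(t)|<\infty$. The convolution operator is $\mathcal{C}_{g_0}(w)(t):=\sum_{\tau\in\mathbb{Z}}g_0(t-\tau)w(\tau)$ for bounded $w$. A sequence $x:\mathbb{Z}\to\mathbb{R}$ is $P$-periodic ($P\in\mathbb{Z}_{>0}$) if $x(i+P)=x(i)$ for all $i$, and then $x^P:=[x(0),\dots,x(P-1)]^\top$. $\boldsymbol{1}_n$ is the all-ones vector in $\mathbb{R}^n$. $\mathrm{sign}(t)=1,0,-1$ for $t>0$, $t=0$, $t<0$, applied entrywise. Cyclic forward difference: for $v\in\mathbb{R}^n$, $\Delta_c v:=[v_2-v_1,\,v_3-v_2,\dots,v_1-v_n]^\top$. Variation: $S^-(v)$ is the number of sign changes between consecutive entries of the vector obtained from $v$ by deleting all zeros, with $S^-(0)=-1$. Cyclic variation: $S_c^-(v):=\max_{1\le i\le n}S^-([v_i,\dots,v_n,v_1,\dots,v_i])$. $S_c^+(v)$ is the maximum of $S_c^-(\bar v)$ over all $\bar v\in\mathbb{R}^n$ obtained from $v$ by replacing its zero entries by arbitrary real numbers. Self-oscillation of $( * )$: a $P$-periodic sequence $u$ satisfying $( * )$ and $S_c^-(\Delta_c u^P)\ge 2$.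
   Formalization: The "in particular" claim is stated for every time shift v of u with v(-1) < 0 ≤ v(0), and such a shift is shown to exist; for an arbitrary phase of u the equivalence and the sign pattern fail, e.g. after shifting u by one step. *)

theory Defs
  imports "HOL-Analysis.Analysis" "HOL-Computational_Algebra.Polynomial"
begin

text \<open>Signals are functions on the integers, vectors of varying length are lists (indexed from 0).\<close>

text \<open>The transfer function is the sum of the series in \<open>1/z\<close> for all complex \<open>z\<close> of large
  modulus, and it is required to agree there with a quotient of real polynomials in \<open>z\<close>.\<close>

definition rational_transfer_function :: "(int \<Rightarrow> real) \<Rightarrow> bool" where
  "rational_transfer_function g \<longleftrightarrow>
     (\<exists>(p::real poly) (q::real poly) R. q \<noteq> 0 \<and>
        (\<forall>z::complex. norm z > R \<longrightarrow>
           poly (map_poly complex_of_real q) z \<noteq> 0 \<and>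
           (\<lambda>t::nat. complex_of_real (g (int t)) * z powi (- int t)) sums
             (poly (map_poly complex_of_real p) z / poly (map_poly complex_of_real q) z)))"

definition finite_dim_causal_impulse_response :: "(int \<Rightarrow> real) \<Rightarrow> bool" where
  "finite_dim_causal_impulse_response g \<longleftrightarrow>
     (\<forall>t<0. g t = 0) \<and> rational_transfer_function g"

definition in_ell1 :: "(int \<Rightarrow> real) \<Rightarrow> bool" where
  "in_ell1 g \<longleftrightarrow> (\<lambda>t. \<bar>g t\<bar>) summable_on UNIV"

definition convolution :: "(int \<Rightarrow> real) \<Rightarrow> (int \<Rightarrow> real) \<Rightarrow> int \<Rightarrow> real" where
  "convolution g w t = (\<Sum>\<^sub>\<infinity>\<tau>\<in>UNIV. g (t - \<tau>) * w \<tau>)"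

definition sign_seq :: "(int \<Rightarrow> real) \<Rightarrow> int \<Rightarrow> real" where
  "sign_seq u t = sgn (u t)"

definition periodic :: "nat \<Rightarrow> (int \<Rightarrow> real) \<Rightarrow> bool" where
  "periodic P x \<longleftrightarrow> P > 0 \<and> (\<forall>i. x (i + int P) = x i)"

definition period_vec :: "nat \<Rightarrow> (int \<Rightarrow> real) \<Rightarrow> real list" where
  "period_vec P x = map (\<lambda>i. x (int i)) [0..<P]"

definition time_shift :: "int \<Rightarrow> (int \<Rightarrow> real) \<Rightarrow> int \<Rightarrow> real" where
  "time_shift s u t = u (t + s)"

definition cyclic_diff :: "real list \<Rightarrow> real list" where
  "cyclic_diff v = map (\<lambda>i. v ! (Suc i mod length v) - v ! i) [0..<length v]"

definition variation :: "real list \<Rightarrow> int" where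
  "variation v = (let w = filter (\<lambda>x. x \<noteq> 0) v in
     if w = [] then -1
     else int (card {i. Suc i < length w \<and> sgn (w ! i) \<noteq> sgn (w ! Suc i)}))"

text \<open>The two cyclic variations are only meaningful for non-empty vectors. Each maximum is over a
  finite non-empty set: a variation is an integer between \<open>-1\<close> and the length of the vector.\<close>

definition cyclic_variation :: "real list \<Rightarrow> int" where
  "cyclic_variation v = Max ((\<lambda>i. variation (drop i v @ take (Suc i) v)) ` {..<length v})"

definition max_cyclic_variation :: "real list \<Rightarrow> int" where
  "max_cyclic_variation v =
     Max (cyclic_variation `
       {w. length w = length v \<and> (\<forall>i<length v. v ! i \<noteq> 0 \<longrightarrow> w ! i = v ! i)})"

definition relay_feedback :: "(int \<Rightarrow> real) \<Rightarrow> nat \<Rightarrow> (int \<Rightarrow> real) \<Rightarrow> bool" where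
  "relay_feedback g Pd u \<longleftrightarrow> (\<forall>t. u t = - convolution g (sign_seq u) (t - int Pd))"

definition self_oscillation :: "(int \<Rightarrow> real) \<Rightarrow> nat \<Rightarrow> nat \<Rightarrow> (int \<Rightarrow> real) \<Rightarrow> bool" where
  "self_oscillation g Pd P u \<longleftrightarrow>
     periodic P u \<and> relay_feedback g Pd u \<and> cyclic_variation (cyclic_diff (period_vec P u)) \<ge> 2"

definition settling_index :: "(int \<Rightarrow> real) \<Rightarrow> nat" where
  "settling_index g =
     (LEAST t. (\<Sum>k<t. g (int k)) - (\<Sum>\<^sub>\<infinity>k\<in>{t..}. g (int k)) > 0)"

text \<open>The feedback equation is invariant under time shifts, so claims about the value at time 0
  and about the sign pattern of the vector starting at time 0 require fixing the phase: time 0 is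
  the start of a half-period, the first time at which the signal is no longer negative.\<close>

definition phase_normalized :: "(int \<Rightarrow> real) \<Rightarrow> bool" where
  "phase_normalized v \<longleftrightarrow> v (-1) < 0 \<and> 0 \<le> v 0"

end

theory Submission
  imports Defs
begin

text \<open>
  \<^bold>\<open>The shape of an oscillation.\<close> The feedback inverts signs and the kernel is positive, so an
  oscillation takes values of both signs (\<open>oscillation_changes_sign\<close>). A maximal cyclic variation of
  2 excludes four times within a period at which the signal alternates, zeros counting as either
  sign (\<open>not_weakly_alternating\<close>). Hence a period consists of one block of positive values and one
  block of negative values, and a zero can only be a single value at a switch. The locale
  \<open>relay_cycle\<close> records this shape for a signal that switches upward at time 0 and downward at \<open>q\<close>.
  Negating the signal and shifting it by \<open>q\<close> gives another such cycle, with \<open>P - q\<close> in place of \<open>q\<close>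
  (\<open>half_turn\<close>).

  \<^bold>\<open>The lower bound.\<close> Since the sign signal is \<open>P\<close>-periodic, the kernel can be folded to a strictly
  decreasing positive weight on one period. As recent signs have the largest weights, the response
  rises during the positive block and falls during the negative one, except perhaps at a switch
  where the signal vanishes (\<open>rising\<close>, \<open>falling\<close>). The signal is the negated response, delayed by \<open>d\<close>,
  so it peaks \<open>d\<close> steps after the response has its minimum at the end of the negative block. The peak
  has to lie in the positive block of length \<open>q\<close>, hence \<open>d \<le> q\<close> (\<open>delay_le_q\<close>). By symmetry
  \<open>d \<le> P - q\<close>, so \<open>2 * d \<le> P\<close>.

  \<^bold>\<open>The upper bound.\<close> Once the signs have been positive for as many steps as the settling index, they
  dominate the response, whatever came before. After the delay the signal is therefore negative, so
  a half-cycle is no longer than the delay plus the settling index (\<open>q_le_delay_plus\<close>).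

  \<^bold>\<open>Equality.\<close> A positive response at the upward switch means that the signal is negative \<open>d\<close> steps
  later, and with \<open>d \<le> q\<close> this forces \<open>q = d\<close>. The sum of the responses at the two switches then shows
  that the negative half-cycle cannot be longer than \<open>d\<close> (\<open>period_eq_half_iff\<close>). Conversely, if
  \<open>P = 2 * d\<close>, both half-cycles have length \<open>d\<close>, and the same sum shows that the signal does not vanish
  at the switches (\<open>half_period_strict_switches\<close>), which gives the sign pattern.
\<close>

section \<open>Convolution\<close>

lemma causal_ell1_summable:
  assumes "in_ell1 g"
  shows "summable (\<lambda>k. g (int k))"
proof -
  have "(\<lambda>t. norm (g t)) summable_on range int"
    using assms unfolding in_ell1_def real_norm_def
    by (rule summable_on_subset_banach) auto
  then have "(\<lambda>k. norm (g (int k))) summable_on UNIV"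
    by (subst (asm) summable_on_reindex) (auto simp: o_def inj_on_def)
  then have "(\<lambda>k. g (int k)) summable_on UNIV"
    by (rule abs_summable_summable)
  then show ?thesis
    by (rule summable_on_imp_summable)
qed

lemma convolution_eq_suminf:
  assumes causal: "\<And>t. t < 0 \<Longrightarrow> g t = 0" and ell1: "in_ell1 g" and bound: "\<And>t. \<bar>w t\<bar> \<le> 1"
  shows "convolution g w t = (\<Sum>k. g (int k) * w (t - int k))"
proof -
  let ?f = "\<lambda>x. g x * w (t - x)"
  have "(\<lambda>x. norm (?f x)) summable_on UNIV"
  proof (rule Infinite_Sum.abs_summable_on_comparison_test)
    show "(\<lambda>x. norm (g x)) summable_on UNIV" using ell1 by (simp add: in_ell1_def)
    show "norm (?f x) \<le> norm (g x)" for x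
      using mult_left_mono[OF bound[of "t - x"] abs_ge_zero[of "g x"]] by (simp add: abs_mult)
  qed
  then have summ: "?f summable_on UNIV" by (rule abs_summable_summable)
  have "convolution g w t = infsum ?f UNIV"
    unfolding convolution_def
    using infsum_reindex_bij_betw[of "\<lambda>x. t - x" UNIV UNIV "\<lambda>\<tau>. g (t - \<tau>) * w \<tau>"]
    by (simp add: bij_betw_def inj_on_def surj_def)
  then have "(?f has_sum convolution g w t) UNIV" using summ by simp
  also have "?this \<longleftrightarrow> (?f has_sum convolution g w t) (range int)"
  proof (rule has_sum_cong_neutral)
    fix x :: int assume "x \<in> UNIV - range int"
    then have "x < 0" by (metis DiffD2 nonneg_int_cases not_less rangeI)
    then show "?f x = 0" using causal by simp
  qed auto
  also have "\<dots> \<longleftrightarrow> ((\<lambda>k. ?f (int k)) has_sum convolution g w t) UNIV"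
    by (subst has_sum_reindex) (auto simp: o_def inj_on_def)
  finally show ?thesis
    by (intro sums_unique has_sum_imp_sums)
qed

lemma summable_residue_class:
  fixes g :: "nat \<Rightarrow> real"
  assumes nonneg: "\<And>k. 0 \<le> g k" and summ: "summable g" and "0 < P"
  shows "summable (\<lambda>n. g (n * P + j))"
proof -
  have "inj (\<lambda>n. n * P + j)" using \<open>0 < P\<close> by (auto simp: inj_on_def)
  then show ?thesis
    using summable_reindex[OF summ _ nonneg, of "\<lambda>n. n * P + j"] by (simp add: o_def)
qed

text \<open>Against a periodic signal only the sums of the kernel over residue classes modulo the period
  matter, which turns the infinite feedback sum into a finite one.\<close>

lemma suminf_periodic_fold:
  fixes g :: "nat \<Rightarrow> real" and s :: "int \<Rightarrow> real"
  assumes nonneg: "\<And>k. 0 \<le> g k" and summ: "summable g" and "0 < P"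
    and period: "\<And>t. s (t + int P) = s t" and bound: "\<And>t. \<bar>s t\<bar> \<le> 1"
  shows "(\<Sum>k. g k * s (t - int k)) = (\<Sum>j<P. (\<Sum>n. g (n * P + j)) * s (t - int j))"
proof -
  have shift: "s (t - int (n * P)) = s t" for t n
  proof (induction n)
    case (Suc n)
    then show ?case using period[of "t - int (Suc n * P)"] by (simp add: algebra_simps)
  qed simp
  have sub: "summable (\<lambda>n. g (n * P + j))" for j
    by (rule summable_residue_class[OF nonneg summ \<open>0 < P\<close>])
  have "norm (g k * s (t - int k)) \<le> g k" for k
    using mult_left_mono[OF bound[of "t - int k"] nonneg[of k]] nonneg[of k] by (simp add: abs_mult)
  then have "summable (\<lambda>k. g k * s (t - int k))"
    by (intro summable_comparison_test'[OF summ])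
  then have "(\<lambda>n. \<Sum>k = n * P..<n * P + P. g k * s (t - int k)) sums (\<Sum>k. g k * s (t - int k))"
    using \<open>0 < P\<close> by (intro sums_group summable_sums)
  also have "(\<lambda>n. \<Sum>k = n * P..<n * P + P. g k * s (t - int k))
      = (\<lambda>n. \<Sum>j<P. g (n * P + j) * s (t - int j))"
  proof
    fix n
    have "(\<Sum>k = n * P..<n * P + P. g k * s (t - int k))
        = (\<Sum>j<P. g (n * P + j) * s (t - int (n * P + j)))"
      using sum.shift_bounds_nat_ivl[of "\<lambda>k. g k * s (t - int k)" 0 "n * P" P]
      by (simp add: add.commute lessThan_atLeast0)
    also have "\<dots> = (\<Sum>j<P. g (n * P + j) * s (t - int j))"
      using shift[of "t - int _" n] by (simp add: algebra_simps)
    finally show "(\<Sum>k = n * P..<n * P + P. g k * s (t - int k))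
        = (\<Sum>j<P. g (n * P + j) * s (t - int j))" .
  qed
  finally have "(\<lambda>n. \<Sum>j<P. g (n * P + j) * s (t - int j)) sums (\<Sum>k. g k * s (t - int k))" .
  moreover have "(\<lambda>n. \<Sum>j<P. g (n * P + j) * s (t - int j))
      sums (\<Sum>j<P. (\<Sum>n. g (n * P + j)) * s (t - int j))"
    by (intro sums_sum sums_mult2 summable_sums sub)
  ultimately show ?thesis by (rule sums_unique2)
qed

section \<open>Variation\<close>

lemma sign_change_between:
  fixes l :: "real list"
  assumes "i < j" "sgn (l ! i) \<noteq> sgn (l ! j)"
  shows "\<exists>k. i \<le> k \<and> k < j \<and> sgn (l ! k) \<noteq> sgn (l ! Suc k)"
proof (rule ccontr)
  assume no: "\<not> ?thesis"
  have "k \<le> j \<longrightarrow> sgn (l ! k) = sgn (l ! i)" if "i \<le> k" for k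
    using that
  proof (induction k rule: dec_induct)
    case (step k)
    then show ?case using no by (metis Suc_le_lessD less_imp_le_nat)
  qed simp
  from this[of j] show False using assms by simp
qed

lemma nth_filter_take:
  assumes "i < length w" "Q (w ! i)"
  shows "filter Q w ! length (filter Q (take i w)) = w ! i"
    and "length (filter Q (take i w)) < length (filter Q w)"
    and "i < j \<Longrightarrow> length (filter Q (take i w)) < length (filter Q (take j w))"
proof -
  have split: "w = take i w @ w ! i # drop (Suc i) w" using assms by (simp add: id_take_nth_drop)
  have "filter Q w = filter Q (take i w) @ w ! i # filter Q (drop (Suc i) w)"
    by (subst split) (simp add: assms)
  then show "filter Q w ! length (filter Q (take i w)) = w ! i"
    and "length (filter Q (take i w)) < length (filter Q w)" by simp_all
  assume "i < j"
  then have "take j w = take (Suc i) w @ take (j - Suc i) (drop (Suc i) w)"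
    by (metis Suc_leI le_add_diff_inverse take_add)
  then show "length (filter Q (take i w)) < length (filter Q (take j w))"
    using assms by (simp add: take_Suc_conv_app_nth)
qed

lemma variation_ge_3:
  assumes "i1 < i2" "i2 < i3" "i3 < i4" "i4 < length w"
    and "w ! i1 * w ! i2 < 0" "w ! i2 * w ! i3 < 0" "w ! i3 * w ! i4 < 0"
  shows "3 \<le> variation w"
proof -
  define l where "l = filter (\<lambda>x. x \<noteq> 0) w"
  define p where "p i = length (filter (\<lambda>x. x \<noteq> 0) (take i w))" for i
  have nz: "w ! i1 \<noteq> 0" "w ! i2 \<noteq> 0" "w ! i3 \<noteq> 0" "w ! i4 \<noteq> 0" using assms by auto
  have len: "i1 < length w" "i2 < length w" "i3 < length w" using assms by auto
  have nth: "l ! p i1 = w ! i1" "l ! p i2 = w ! i2" "l ! p i3 = w ! i3" "l ! p i4 = w ! i4"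
    unfolding l_def p_def by (intro nth_filter_take(1) len assms nz)+
  have lt: "p i1 < p i2" "p i2 < p i3" "p i3 < p i4"
    unfolding p_def by (intro nth_filter_take(3) len assms nz)+
  have bnd: "p i4 < length l"
    unfolding l_def p_def by (intro nth_filter_take(2) assms nz)
  have sgn: "sgn (l ! p i1) \<noteq> sgn (l ! p i2)" "sgn (l ! p i2) \<noteq> sgn (l ! p i3)"
    "sgn (l ! p i3) \<noteq> sgn (l ! p i4)"
    unfolding nth using assms by (auto simp: mult_less_0_iff)
  obtain k1 where k1: "p i1 \<le> k1" "k1 < p i2" "sgn (l ! k1) \<noteq> sgn (l ! Suc k1)"
    using sign_change_between[OF lt(1) sgn(1)] by blast
  obtain k2 where k2: "p i2 \<le> k2" "k2 < p i3" "sgn (l ! k2) \<noteq> sgn (l ! Suc k2)"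
    using sign_change_between[OF lt(2) sgn(2)] by blast
  obtain k3 where k3: "p i3 \<le> k3" "k3 < p i4" "sgn (l ! k3) \<noteq> sgn (l ! Suc k3)"
    using sign_change_between[OF lt(3) sgn(3)] by blast
  let ?S = "{i. Suc i < length l \<and> sgn (l ! i) \<noteq> sgn (l ! Suc i)}"
  have "card {k1, k2, k3} \<le> card ?S"
  proof (rule card_mono)
    show "finite ?S" by (rule finite_subset[of _ "{..<length l}"]) auto
    show "{k1, k2, k3} \<subseteq> ?S" using k1 k2 k3 bnd lt by auto
  qed
  moreover have "k1 < k2" "k2 < k3" using k1 k2 k3 by linarith+
  then have "card {k1, k2, k3} = 3" by simp
  ultimately have "3 \<le> int (card ?S)" by linarith
  moreover have "l \<noteq> []" using bnd by auto
  then have "variation w = int (card ?S)"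
    unfolding variation_def Let_def l_def[symmetric] by (rule if_not_P)
  ultimately show ?thesis by simp
qed

lemma variation_bounds: "variation w \<in> {-1..int (length w)}"
proof -
  let ?l = "filter (\<lambda>x. x \<noteq> 0) w"
  have "card {i. Suc i < length ?l \<and> sgn (?l ! i) \<noteq> sgn (?l ! Suc i)} \<le> card {..<length ?l}"
    by (rule card_mono) auto
  also have "\<dots> \<le> length w" by simp
  finally show ?thesis by (auto simp: variation_def Let_def)
qed

lemma cyclic_variation_bounds:
  assumes "w \<noteq> []"
  shows "cyclic_variation w \<in> {-1..int (length w) + 1}"
proof -
  have "cyclic_variation w \<in> (\<lambda>i. variation (drop i w @ take (Suc i) w)) ` {..<length w}"
    unfolding cyclic_variation_def using assms by (intro Max_in) auto
  then obtain i where "i < length w" "cyclic_variation w = variation (drop i w @ take (Suc i) w)"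
    by auto
  then show ?thesis using variation_bounds[of "drop i w @ take (Suc i) w"] by auto
qed

text \<open>A zero at one of the four positions may be replaced by a number of the sign that completes
  the alternation. The sign \<open>\<sigma>\<close> of the first position is left open because a time window of one
  period, read from its own start, is a rotation of the vector.\<close>

lemma max_cyclic_variation_ge_3:
  fixes v :: "real list" and \<sigma> :: real
  assumes ord: "i1 < i2" "i2 < i3" "i3 < i4" "i4 < length v" and "\<sigma> \<noteq> 0"
    and alt: "0 \<le> \<sigma> * v ! i1" "\<sigma> * v ! i2 \<le> 0" "0 \<le> \<sigma> * v ! i3" "\<sigma> * v ! i4 \<le> 0"
  shows "3 \<le> max_cyclic_variation v"
proof -
  define w where "w = map (\<lambda>i. if v ! i \<noteq> 0 then v ! i else if i \<in> {i1, i3} then \<sigma> else - \<sigma>)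
    [0..<length v]"
  let ?W = "{w. length w = length v \<and> (\<forall>i<length v. v ! i \<noteq> 0 \<longrightarrow> w ! i = v ! i)}"
  have w: "w \<in> ?W" by (simp add: w_def)
  have len: "length w = length v" by (simp add: w_def)
  have \<sigma>2: "\<sigma> * \<sigma> > 0" using \<open>\<sigma> \<noteq> 0\<close> not_real_square_gt_zero by blast
  have w_nth: "w ! i = (if v ! i \<noteq> 0 then v ! i else if i \<in> {i1, i3} then \<sigma> else - \<sigma>)"
    if "i < length v" for i using that by (simp add: w_def)
  have sg: "0 < \<sigma> * w ! i1" "\<sigma> * w ! i2 < 0" "0 < \<sigma> * w ! i3" "\<sigma> * w ! i4 < 0"
    using ord alt \<sigma>2 \<open>\<sigma> \<noteq> 0\<close> by (simp_all add: w_nth order_less_le)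
  have prod: "x * y < 0" if "\<sigma> * x > 0 \<and> \<sigma> * y < 0 \<or> \<sigma> * x < 0 \<and> \<sigma> * y > 0" for x y
    using that unfolding zero_less_mult_iff mult_less_0_iff by linarith
  have nth: "(w @ take (Suc 0) w) ! i = w ! i" if "i < length v" for i
    using that len by (simp add: nth_append)
  have "3 \<le> variation (drop 0 w @ take (Suc 0) w)"
    unfolding drop_0
  proof (rule variation_ge_3[OF ord(1-3)])
    show "i4 < length (w @ take (Suc 0) w)" using ord len by simp
  qed (use ord in \<open>simp_all add: nth prod sg\<close>)
  also have "\<dots> \<le> cyclic_variation w"
    unfolding cyclic_variation_def
  proof (rule Max_ge)
    show "variation (drop 0 w @ take (Suc 0) w)
        \<in> (\<lambda>i. variation (drop i w @ take (Suc i) w)) ` {..<length w}"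
    proof (rule imageI)
      show "0 \<in> {..<length w}" using ord len by (simp only: lessThan_iff)
    qed
  qed simp
  also have "\<dots> \<le> max_cyclic_variation v"
    unfolding max_cyclic_variation_def
  proof (rule Max_ge)
    have "cyclic_variation x \<in> {-1..int (length v) + 1}" if "x \<in> ?W" for x
    proof -
      have "length x = length v" using that by simp
      moreover have "x \<noteq> []" using \<open>length x = length v\<close> ord(4) by (cases x) simp_all
      ultimately show ?thesis using cyclic_variation_bounds[of x] by simp
    qed
    then have "cyclic_variation ` ?W \<subseteq> {-1..int (length v) + 1}" by (rule image_subsetI)
    then show "finite (cyclic_variation ` ?W)" by (rule finite_subset) simp
    show "cyclic_variation w \<in> cyclic_variation ` ?W" using w by (rule imageI)
  qed
  finally show ?thesis .
qed

text \<open>Zeros count as having either sign, since the maximal cyclic variation may fill them in either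
  way. The four times fit into one period.\<close>

definition weakly_alternating :: "nat \<Rightarrow> (int \<Rightarrow> real) \<Rightarrow> bool" where
  "weakly_alternating P u \<longleftrightarrow> (\<exists>a b c d. a < b \<and> b < c \<and> c < d \<and> d < a + int P \<and>
     0 \<le> u a \<and> u b \<le> 0 \<and> 0 \<le> u c \<and> u d \<le> 0)"

lemma periodic_add_mult:
  assumes "periodic P u"
  shows "u (t + k * int P) = u t"
proof -
  have step: "u (t + int n * int P) = u t" for t n
  proof (induction n)
    case (Suc n)
    have "u (t + int n * int P + int P) = u (t + int n * int P)"
      using assms unfolding periodic_def by blast
    with Suc show ?case by (simp add: algebra_simps)
  qed simp
  show ?thesis
  proof (cases "0 \<le> k")
    case True
    then show ?thesis using step[of t "nat k"] by simp
  next
    case False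
    then show ?thesis using step[of "t + k * int P" "nat (- k)"] by (simp add: algebra_simps)
  qed
qed

text \<open>A weak alternation in a window of one period is, after reduction modulo the period, a rotation of
  one at indices of the vector, and the vector with zeros filled in accordingly has variation at
  least 3.\<close>

lemma not_weakly_alternating:
  assumes per: "periodic P u" and le: "max_cyclic_variation (period_vec P u) \<le> 2"
  shows "\<not> weakly_alternating P u"
proof
  assume "weakly_alternating P u"
  then obtain a b c d where abcd: "a < b" "b < c" "c < d" "d < a + int P"
      "0 \<le> u a" "u b \<le> 0" "0 \<le> u c" "u d \<le> 0"
    unfolding weakly_alternating_def by blast
  have P: "0 < int P" using per by (simp add: periodic_def)
  have no: False if "0 \<le> x1" "x1 < x2" "x2 < x3" "x3 < x4" "x4 < int P" "\<sigma> \<noteq> 0"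
     "0 \<le> \<sigma> * u x1" "\<sigma> * u x2 \<le> 0" "0 \<le> \<sigma> * u x3" "\<sigma> * u x4 \<le> 0" for x1 x2 x3 x4 \<sigma>
    using max_cyclic_variation_ge_3[of "nat x1" "nat x2" "nat x3" "nat x4" "period_vec P u" \<sigma>]
      that le by (simp add: period_vec_def nat_less_iff)
  define r where "r = - (a div int P)"
  define a' b' c' d' where "a' = a + r * int P" and "b' = b + r * int P"
    and "c' = c + r * int P" and "d' = d + r * int P"
  note primed = a'_def b'_def c'_def d'_def
  have "a' = a mod int P" by (simp add: a'_def r_def minus_div_mult_eq_mod[symmetric])
  then have a': "0 \<le> a'" "a' < int P" using P by auto
  have ord: "a' < b'" "b' < c'" "c' < d'" "d' < a' + int P" using abcd by (auto simp: primed)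
  have val: "0 \<le> u a'" "u b' \<le> 0" "0 \<le> u c'" "u d' \<le> 0"
    using abcd by (simp_all add: primed periodic_add_mult[OF per])
  have wrap: "u (t - int P) = u t" for t
    using periodic_add_mult[OF per, of t "-1"] by simp
  consider "d' < int P" | "c' < int P" "int P \<le> d'" | "b' < int P" "int P \<le> c'" | "int P \<le> b'"
    by linarith
  then show False
  proof cases
    case 1
    then show False using no[of a' b' c' d' 1] a' ord val by simp
  next
    case 2
    then show False using no[of "d' - int P" a' b' c' "-1"] a' ord val wrap by simp
  next
    case 3
    then show False using no[of "c' - int P" "d' - int P" a' b' 1] a' ord val wrap by simp
  next
    case 4
    then show False using no[of "b' - int P" "c' - int P" "d' - int P" a' "-1"] a' ord val wrap by simp
  qed
qed


section \<open>One switching cycle\<close>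

text \<open>Subtracting the value \<open>h m\<close> at the crossing from all weights does not change the sum, and
  afterwards each weight has the sign of its coefficient.\<close>

lemma sum_single_crossing_nonneg:
  fixes h c :: "nat \<Rightarrow> real"
  assumes dec: "\<And>i j. i \<le> j \<Longrightarrow> h j \<le> h i" and zero: "(\<Sum>j<P. c j) = 0"
    and le: "\<And>j. j \<le> m \<Longrightarrow> 0 \<le> c j" and gt: "\<And>j. m < j \<Longrightarrow> j < P \<Longrightarrow> c j \<le> 0"
  shows "0 \<le> (\<Sum>j<P. h j * c j)"
proof -
  have "0 \<le> (\<Sum>j<P. (h j - h m) * c j)"
  proof (rule sum_nonneg)
    fix j assume "j \<in> {..<P}"
    then show "0 \<le> (h j - h m) * c j"
      by (cases "j \<le> m") (auto intro!: mult_nonneg_nonneg mult_nonpos_nonpos simp: dec le gt)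
  qed
  also have "\<dots> = (\<Sum>j<P. h j * c j)"
    by (simp add: left_diff_distrib sum_subtractf zero flip: sum_distrib_left)
  finally show ?thesis .
qed

text \<open>The normal form of an oscillation: time 0 is the upward switch and \<open>q\<close> the downward switch.
  The signal may vanish at these two times, but nowhere else in the period. The roles of the two
  half-cycles are exchanged by \<open>half_turn\<close>, so every estimate on the positive half-cycle of length
  \<open>q\<close> yields one on the negative half-cycle of length \<open>P - q\<close>.\<close>

locale relay_cycle =
  fixes P d :: nat and q :: int and g :: "nat \<Rightarrow> real" and v :: "int \<Rightarrow> real"
  assumes periodic: "periodic P v"
    and q_bounds: "0 < q" "q < int P"
    and d_bounds: "1 \<le> d" "d \<le> P"
    and start: "v (-1) < 0" "0 \<le> v 0"
    and plus: "\<And>t. 0 < t \<Longrightarrow> t < q \<Longrightarrow> 0 < v t"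
    and stop: "0 < v (q - 1)" "v q \<le> 0"
    and minus: "\<And>t. q < t \<Longrightarrow> t < int P \<Longrightarrow> v t < 0"
    and g_pos: "\<And>k. 0 < g k"
    and g_decreasing: "\<And>i j. i < j \<Longrightarrow> g j < g i"
    and g_summable: "summable g"
    and feedback: "\<And>t. v (t + int d) = - (\<Sum>k. g k * sgn (v (t - int k)))"
begin

lemma v_shift: "v (t + int P) = v t" "v (t - int P) = v t"
  using periodic_add_mult[OF periodic, of t 1] periodic_add_mult[OF periodic, of t "-1"] by simp_all

lemma half_turn: "relay_cycle P d (int P - q) g (\<lambda>t. - v (t + q))"
proof
  show "periodic P (\<lambda>t. - v (t + q))"
    using periodic by (auto simp: periodic_def algebra_simps)
      (metis add.assoc add.commute)
  show "0 < - v (t + q)" if "0 < t" "t < int P - q" for t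
    using minus[of "t + q"] that by simp
  show "- v (t + q) < 0" if "int P - q < t" "t < int P" for t
    using plus[of "t + q - int P"] that v_shift(2)[of "t + q"] by simp
  show "- v (t + int d + q) = - (\<Sum>k. g k * sgn (- v (t - int k + q)))" for t
  proof -
    have "summable (\<lambda>k. g k * sgn (v (t + q - int k)))"
      by (rule summable_comparison_test'[OF g_summable])
        (simp add: abs_mult abs_sgn_eq less_imp_le[OF g_pos])
    then show ?thesis
      using feedback[of "t + q"] by (simp add: sgn_minus suminf_minus algebra_simps)
  qed
  have "v (int P - 1) < 0" using v_shift(1)[of "-1"] start by simp
  then show "0 < - v (int P - q - 1 + q)" by simp
  show "- v (int P - q + q) \<le> 0" using v_shift(1)[of 0] start by simp
qed (use q_bounds d_bounds stop g_pos g_decreasing g_summable in auto)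

definition kernel :: "nat \<Rightarrow> real" where
  "kernel j = (\<Sum>n. g (n * P + j))"

definition response :: "int \<Rightarrow> real" where
  "response t = (\<Sum>j<P. kernel j * sgn (v (t - int j)))"

lemma feedback_folded: "v (t + int d) = - response t"
  unfolding feedback response_def kernel_def
  using suminf_periodic_fold[of g P "\<lambda>t. sgn (v t)" t] q_bounds
  by (simp add: less_imp_le[OF g_pos] g_summable v_shift abs_sgn_eq)

lemma response_shift: "response (t + int P) = response t" "response (t - int P) = response t"
  using feedback_folded[of t] feedback_folded[of "t + int P"] feedback_folded[of "t - int P"]
    v_shift(1)[of "t + int d"] v_shift(2)[of "t + int d"]
  by (simp_all add: algebra_simps)

lemma kernel_summable: "summable (\<lambda>n. g (n * P + j))"
  using q_bounds by (intro summable_residue_class less_imp_le[OF g_pos] g_summable) simp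

lemma kernel_pos: "0 < kernel j"
  unfolding kernel_def by (intro suminf_pos kernel_summable g_pos)

lemma kernel_decreasing:
  assumes "i < j"
  shows "kernel j < kernel i"
proof -
  have "0 < (\<Sum>n. g (n * P + i) - g (n * P + j))"
    using assms by (intro suminf_pos summable_diff kernel_summable) (simp add: g_decreasing)
  then show ?thesis by (simp add: kernel_def suminf_diff[symmetric] kernel_summable)
qed

lemma kernel_antimono: "i \<le> j \<Longrightarrow> kernel j \<le> kernel i"
  using kernel_decreasing[of i j] by (cases "i = j") auto

text \<open>Going back in time from \<open>t\<close>, the sign signal first has its upward and then its downward jumps.
  Hence its increments change sign once, from nonnegative to nonpositive, and over a period they
  sum to zero; the kernel gives more weight to the recent ones. If the signal vanishes at time 0,
  half of the upward jump falls on time 1 and the argument fails for \<open>t = 0\<close>, whence the last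
  hypothesis.\<close>

lemma rising_step:
  assumes t: "0 \<le> t" "t < q" and "t = 0 \<Longrightarrow> 0 < v 0"
  shows "response (t - 1) \<le> response t"
proof -
  define c where "c j = sgn (v (t - int j)) - sgn (v (t - 1 - int j))" for j
  have "(\<Sum>j<P. c j) = (\<Sum>j<P. sgn (v (t - int j)) - sgn (v (t - int (Suc j))))"
    by (simp add: c_def algebra_simps)
  also have "\<dots> = 0"
    using sum_lessThan_telescope'[of "\<lambda>j. sgn (v (t - int j))" P] by (simp add: v_shift)
  finally have zero: "(\<Sum>j<P. c j) = 0" .
  have "0 \<le> (\<Sum>j<P. kernel j * c j)"
  proof (rule sum_single_crossing_nonneg[where m = "nat t", OF kernel_antimono zero])
    fix j assume "j \<le> nat t"
    then consider "t - int j = 0" | "0 < t - int j" "t - int j < q" using t by linarith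
    then show "0 \<le> c j"
    proof cases
      case 1
      then have "t - 1 - int j = -1" by simp
      with 1 start show ?thesis by (simp add: c_def)
    next
      case 2
      then show ?thesis using plus[OF 2] by (simp add: c_def sgn_if)
    qed
  next
    fix j assume j: "nat t < j" "j < P"
    define x where "x = t - int j + int P"
    have x: "t < x" "x < int P" using j t by (auto simp: x_def)
    have c: "c j = sgn (v x) - sgn (v (x - 1))"
      using v_shift(1)[of "t - int j"] v_shift(1)[of "t - 1 - int j"]
      by (simp add: c_def x_def algebra_simps)
    consider "x < q" | "x = q" | "q < x" by linarith
    then show "c j \<le> 0"
    proof cases
      case 1
      then have "0 < v (x - 1)" using x t assms(3) plus[of "x - 1"] by (cases "x = 1") auto
      then show ?thesis by (simp add: c sgn_if)
    next
      case 2
      then show ?thesis using stop by (simp add: c sgn_if)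
    next
      case 3
      then show ?thesis using minus[of x] x by (simp add: c sgn_if)
    qed
  qed
  then show ?thesis by (simp add: c_def response_def right_diff_distrib sum_subtractf)
qed

lemma rising:
  assumes "0 \<le> a" "a \<le> b" "b < q"
  shows "response a \<le> response b"
  using \<open>a \<le> b\<close> \<open>b < q\<close>
proof (induction b rule: int_ge_induct)
  case (step b)
  then show ?case using rising_step[of "b + 1"] assms(1) by simp
qed simp

lemma falling:
  assumes "q \<le> a" "a \<le> b" "b < int P"
  shows "response b \<le> response a"
proof -
  interpret flip: relay_cycle P d "int P - q" g "\<lambda>t. - v (t + q)" by (rule half_turn)
  have "flip.response t = - response (t + q)" for t
    by (simp add: flip.response_def response_def sgn_minus sum_negf algebra_simps)
  then show ?thesis using flip.rising[of "a - q" "b - q"] assms by simp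
qed

text \<open>The response is smallest when the signal is about to switch upward, so the signal peaks at time
  \<open>d - 1\<close>, which must therefore belong to the positive half-cycle. A zero at time 0 can move the
  minimum of the response by one step, and the proof avoids locating it: if \<open>d\<close> exceeded \<open>q\<close>, the
  response would be nonnegative at time \<open>- 1\<close>, at the end of its descent, while the last positive
  value of the signal, at \<open>q - 1\<close>, requires a negative response earlier in the descent.\<close>

lemma delay_le_q: "int d \<le> q"
proof (rule ccontr)
  assume "\<not> int d \<le> q"
  then have d: "q < int d" "d \<le> P" using d_bounds by auto
  have "v (int d - 1) \<le> 0"
    using minus[of "int d - 1"] stop d by (cases "int d - 1 = q") auto
  then have last: "0 \<le> response (-1)" using feedback_folded[of "-1"] by simp
  have neg: "response (q - 1 - int d + int P) < 0"
    using feedback_folded[of "q - 1 - int d + int P"] v_shift(1)[of "q - 1"] stop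
    by (simp add: algebra_simps)
  show False
  \<comment> \<open>For \<open>d = P\<close> that earlier time falls back into the ascent and has to be treated apart.\<close>
  proof (cases "d = P")
    case True
    then have "response 0 < 0" using neg rising[of 0 "q - 1"] q_bounds by simp
    then have "0 < v 0" using feedback_folded[of 0] v_shift(1)[of 0] True by simp
    then show False using rising_step[of 0] last \<open>response 0 < 0\<close> q_bounds by simp
  next
    case False
    then have "response (int P - 1) \<le> response (q - 1 - int d + int P)"
      using d q_bounds by (intro falling) auto
    then show False using response_shift(1)[of "-1"] last neg by simp
  qed
qed

lemma delay_le_rest: "int d \<le> int P - q"
  using half_turn by (rule relay_cycle.delay_le_q)

text \<open>The last positive value of the signal, at \<open>q - 1\<close>, is caused by a negative response at
  \<open>T = q - 1 - d\<close>. If \<open>N \<le> T\<close>, the \<open>N\<close> most recent signs seen from \<open>T\<close> are all positive and outweigh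
  the remaining ones whatever these are, so the response is positive. The sign at time 0, which may
  be zero, is not among those \<open>N\<close>.\<close>

lemma q_le_delay_plus:
  assumes N: "(\<Sum>k. g (k + N)) < (\<Sum>k<N. g k)"
  shows "q \<le> int (d + N)"
proof (rule ccontr)
  assume "\<not> q \<le> int (d + N)"
  define T where "T = q - 1 - int d"
  have T: "int N \<le> T" "T < q" using \<open>\<not> q \<le> int (d + N)\<close> by (auto simp: T_def)
  define f where "f k = g k * sgn (v (T - int k))" for k
  have bound: "\<bar>f k\<bar> \<le> g k" for k
    using g_pos[of k] by (simp add: f_def abs_mult abs_sgn_eq)
  have f: "summable f"
    by (rule summable_comparison_test'[OF g_summable]) (simp add: bound)
  have tails: "summable (\<lambda>k. f (k + N))" "summable (\<lambda>k. - g (k + N))"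
    by (simp_all add: f g_summable summable_iff_shift summable_minus)
  have "- (\<Sum>k. g (k + N)) = (\<Sum>k. - g (k + N))"
    by (simp add: suminf_minus g_summable summable_iff_shift)
  also have "\<dots> \<le> (\<Sum>k. f (k + N))"
    using bound by (intro suminf_le tails) (metis abs_le_iff minus_le_iff)
  finally have tail: "- (\<Sum>k. g (k + N)) \<le> (\<Sum>k. f (k + N))" .
  have "(\<Sum>k<N. f k) = (\<Sum>k<N. g k)"
  proof (rule sum.cong)
    fix k assume "k \<in> {..<N}"
    then show "f k = g k" using plus[of "T - int k"] T by (simp add: f_def)
  qed simp
  then have "0 < suminf f" using tail N suminf_split_initial_segment[OF f, of N] by simp
  moreover have "v (q - 1) = - suminf f" using feedback[of T] by (simp add: T_def f_def[abs_def])
  ultimately show False using stop by simp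
qed

lemma period_le:
  assumes "(\<Sum>k. g (k + N)) < (\<Sum>k<N. g k)"
  shows "P \<le> 2 * (d + N)"
  using q_le_delay_plus[OF assms] relay_cycle.q_le_delay_plus[OF half_turn assms] by simp

lemma delay_le_half: "2 * d \<le> P"
  using delay_le_q delay_le_rest by simp

text \<open>With half-cycles of equal length \<open>d = q\<close>, the signs cancel in pairs half a period apart except
  at the switches. So \<open>v 0 + v q\<close> is a negative multiple of \<open>sgn (v 0) + sgn (v q)\<close>, and this sum
  of signs must vanish: the switches are both strict or both zero. In the second case the response
  at 0 would be negative, because the recent negative signs outweigh the older positive ones; but
  it equals \<open>- v q = 0\<close>.\<close>

lemma half_period_strict_switches:
  assumes "P = 2 * d"
  shows "q = int d" "0 < v 0" "v q < 0"
proof -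
  show q: "q = int d" using delay_le_q delay_le_rest assms by simp
  then have P: "int P = q + q" using assms by simp
  have d: "d < P" "0 < d" using assms d_bounds by auto
  have v0: "v 0 = - response q" using feedback_folded[of q] q P v_shift(1)[of 0] by simp
  have vq: "v q = - response 0" using feedback_folded[of 0] q by simp
  have neg: "v (- int j) < 0" if "0 < j" "j < d" for j
    using minus[of "int P - int j"] v_shift(1)[of "- int j"] that P q by simp
  have "response 0 + response q = (\<Sum>j<P. kernel j * (sgn (v (- int j)) + sgn (v (q - int j))))"
    by (simp add: response_def sum.distrib distrib_left)
  also have "\<dots> = (\<Sum>j\<in>{0, d}. kernel j * (sgn (v (- int j)) + sgn (v (q - int j))))"
  proof (rule sum.mono_neutral_right)
    show "\<forall>j\<in>{..<P} - {0, d}. kernel j * (sgn (v (- int j)) + sgn (v (q - int j))) = 0"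
    proof
      fix j assume "j \<in> {..<P} - {0, d}"
      then have j: "j < P" "0 < j" "j \<noteq> d" by auto
      show "kernel j * (sgn (v (- int j)) + sgn (v (q - int j))) = 0"
      proof (cases "j < d")
        case True
        then have "v (- int j) < 0" "0 < v (q - int j)" using neg plus[of "q - int j"] j q by auto
        then show ?thesis by simp
      next
        case False
        then have "0 < v (- int j)" "v (q - int j) < 0"
          using plus[of "int P - int j"] v_shift(1)[of "- int j"]
            minus[of "q - int j + int P"] v_shift(1)[of "q - int j"] j q P by auto
        then show ?thesis by simp
      qed
    qed
  qed (use d in auto)
  also have "\<dots> = (kernel 0 + kernel d) * (sgn (v 0) + sgn (v q))"
    using d q v_shift(1)[of "- q"] P by (simp add: algebra_simps)
  finally have sum: "- (v 0 + v q) = (kernel 0 + kernel d) * (sgn (v 0) + sgn (v q))"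
    using v0 vq by simp
  have hh: "0 < kernel 0 + kernel d" using kernel_pos[of 0] kernel_pos[of d] by simp
  have "\<not> (v 0 = 0 \<and> v q = 0)"
  proof
    assume zero: "v 0 = 0 \<and> v q = 0"
    then have "d \<noteq> 1" using stop q by auto
    then have "1 < d" using \<open>0 < d\<close> by linarith
    define f where "f j = kernel j * sgn (v (- int j))" for j
    have "(\<Sum>j<d + e. f j) = (\<Sum>j<d. f j) + (\<Sum>j<e. f (d + j))" for e
      by (induction e) (simp_all add: add.assoc)
    then have "(\<Sum>j<d + d. f j) = (\<Sum>j<d. f j + f (d + j))" by (simp add: sum.distrib)
    moreover have "response 0 = (\<Sum>j<P. f j)" by (simp add: response_def f_def)
    ultimately have "response 0 = (\<Sum>j<d. f j + f (d + j))" using assms by (simp only: mult_2)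
    also have "\<dots> < (\<Sum>j<d. 0)"
    proof (rule sum_strict_mono_ex1)
      have "f j + f (d + j) = kernel (d + j) - kernel j" if "0 < j" "j < d" for j
        using neg[OF that] plus[of "q - int j"] v_shift(1)[of "- int (d + j)"] that P q
        by (simp add: f_def algebra_simps)
      then have pair: "f j + f (d + j) < 0" if "0 < j" "j < d" for j
        using that kernel_decreasing[of j "d + j"] by simp
      have "f 0 + f (d + 0) = 0"
        using zero v_shift(1)[of "- q"] P q by (simp add: f_def)
      then show "\<forall>j\<in>{..<d}. f j + f (d + j) \<le> 0"
        using pair by (metis lessThan_iff less_imp_le order_refl neq0_conv)
      show "\<exists>j\<in>{..<d}. f j + f (d + j) < 0"
        using pair[of 1] \<open>1 < d\<close> by (intro bexI[of _ 1]) simp_all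
    qed simp
    finally show False using vq zero by simp
  qed
  then have "0 < v 0 \<and> v q < 0"
    using sum hh start(2) stop(2) 
    by (cases "v 0 = 0"; cases "v q = 0") (auto simp: sgn_if)
  then show "0 < v 0" "v q < 0" by auto
qed

text \<open>A positive response at 0 makes \<open>v d\<close> negative and hence \<open>q = d\<close>. If the negative half-cycle were
  longer than \<open>d\<close>, then \<open>v (2 * q) < 0\<close> and the response at \<open>q\<close> would be positive too. But two
  times at distance \<open>q\<close> never carry signs of positive sum when more than half of the period is
  negative, so the responses at 0 and \<open>q\<close> have a nonpositive sum.\<close>

lemma period_eq_half_iff: "P = 2 * d \<longleftrightarrow> 0 < response 0"
proof
  assume "P = 2 * d"
  then show "0 < response 0" using half_period_strict_switches feedback_folded[of 0] by auto
next
  assume y0: "0 < response 0"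
  then have "v (int d) < 0" using feedback_folded[of 0] by simp
  then have q: "q = int d"
    using delay_le_q plus[of "int d"] d_bounds by (cases "int d < q") auto
  then have vq: "v q < 0" using \<open>v (int d) < 0\<close> by simp
  show "P = 2 * d"
  proof (rule ccontr)
    assume "P \<noteq> 2 * d"
    then have P: "2 * q < int P" using delay_le_half q by simp
    have "v (2 * q) < 0" using minus[of "2 * q"] P q_bounds by simp
    then have yq: "0 < response q" using feedback_folded[of q] q by simp
    have opp: "sgn (v (- int j)) + sgn (v (q - int j)) \<le> 0" if "j < P" for j
    proof -
      have neg: "v t < 0" if "q \<le> t" "t < int P" for t
        using minus[of t] vq that by (cases "t = q") auto
      have sg: "sgn a + sgn b \<le> 0" if "a < 0 \<or> b < 0" for a b :: real
        using that by (auto simp: sgn_if)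
      have "v (- int j) < 0 \<or> v (q - int j) < 0"
      proof (cases "0 < j \<and> int j \<le> int P - q")
        case True
        then show ?thesis using neg[of "int P - int j"] v_shift(1)[of "- int j"] by simp
      next
        case False
        then have "j = 0 \<or> int P - q < int j" by auto
        then show ?thesis
          using neg[of "q - int j + int P"] v_shift(1)[of "q - int j"] vq P that by auto
      qed
      then show ?thesis by (rule sg)
    qed
    have "response 0 + response q = (\<Sum>j<P. kernel j * (sgn (v (- int j)) + sgn (v (q - int j))))"
      by (simp add: response_def sum.distrib distrib_left)
    also have "\<dots> \<le> 0"
      using opp kernel_pos by (intro sum_nonpos mult_nonneg_nonpos) (auto intro: less_imp_le)
    finally show False using y0 yq by simp
  qed
qed

end

section \<open>Finding the switching cycle of an oscillation\<close>

text \<open>A settling index exists because the head of the series tends to its positive sum and the tail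
  to 0.\<close>

lemma settling_index_tail_less:
  assumes pos: "\<And>k. 0 < g (int k)" and summ: "summable (\<lambda>k. g (int k))"
  defines "N \<equiv> settling_index g"
  shows "(\<Sum>k. g (int (k + N))) < (\<Sum>k<N. g (int k))"
proof -
  have tail: "(\<Sum>\<^sub>\<infinity>k\<in>{t..}. g (int k)) = (\<Sum>k. g (int (k + t)))" for t
  proof -
    have "bij_betw (\<lambda>k. k + t) UNIV {t..}"
      by (rule bij_betw_byWitness[where f' = "\<lambda>k. k - t"]) auto
    then have "(\<Sum>\<^sub>\<infinity>k\<in>{t..}. g (int k)) = (\<Sum>\<^sub>\<infinity>k. g (int (k + t)))"
      by (rule infsum_reindex_bij_betw[symmetric])
    moreover have "summable (\<lambda>k. g (int (k + t)))"
      using summ summable_iff_shift[of "\<lambda>k. g (int k)" t] by blast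
    then have "((\<lambda>k. g (int (k + t))) has_sum (\<Sum>k. g (int (k + t)))) UNIV"
      using less_imp_le[OF pos] by (intro sums_nonneg_imp_has_sum summable_sums)
    ultimately show ?thesis using infsumI by metis
  qed
  define S where "S = (\<Sum>k. g (int k))"
  have "0 < S" unfolding S_def by (intro suminf_pos summ pos)
  then have "\<forall>\<^sub>F t in sequentially. S / 2 < (\<Sum>k<t. g (int k))"
    using summable_LIMSEQ[OF summ] by (intro order_tendstoD(1)) (auto simp: S_def)
  then obtain t where "S / 2 < (\<Sum>k<t. g (int k))"
    using eventually_happens'[OF sequentially_bot] by blast
  then have "0 < (\<Sum>k<t. g (int k)) - (\<Sum>\<^sub>\<infinity>k\<in>{t..}. g (int k))"
    using suminf_split_initial_segment[OF summ, of t] by (simp add: tail S_def)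
  then have "0 < (\<Sum>k<N. g (int k)) - (\<Sum>\<^sub>\<infinity>k\<in>{N..}. g (int k))"
    unfolding N_def settling_index_def by (rule LeastI)
  then show ?thesis by (simp add: tail)
qed

lemma relay_feedback_suminf:
  assumes "\<And>t. t < 0 \<Longrightarrow> g t = 0" "in_ell1 g" "relay_feedback g d u"
  shows "u (t + int d) = - (\<Sum>k. g (int k) * sgn (u (t - int k)))"
  using assms(3) convolution_eq_suminf[OF assms(1,2), of "sign_seq u" t]
  by (simp add: relay_feedback_def sign_seq_def abs_sgn_eq)

lemma cyclic_variation_diff_zero:
  assumes "\<And>t. u t = 0" "0 < P"
  shows "cyclic_variation (cyclic_diff (period_vec P u)) = -1"
proof -
  have diff: "cyclic_diff (period_vec P u) = replicate P 0"
    using assms by (intro nth_equalityI) (auto simp: cyclic_diff_def period_vec_def)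
  have zero: "variation (drop i (replicate P 0) @ take (Suc i) (replicate P 0)) = -1" for i
    by (simp add: variation_def)
  have "(\<lambda>i. variation (drop i (replicate P 0) @ take (Suc i) (replicate P 0)))
      ` {..<length (replicate P (0::real))} = {-1}"
    unfolding zero using assms(2) by auto
  then show ?thesis unfolding diff cyclic_variation_def by simp
qed

text \<open>The loop inverts signs and its kernel is positive, so a signal of constant sign would have to be
  zero, which is not an oscillation.\<close>

lemma oscillation_changes_sign:
  fixes \<epsilon> :: real
  assumes causal: "\<And>t. t < 0 \<Longrightarrow> g t = 0" and ell1: "in_ell1 g" and pos: "\<And>k. 0 < g (int k)"
    and osc: "self_oscillation g d P u" and "\<epsilon> \<noteq> 0"
  shows "\<exists>t. 0 < \<epsilon> * u t"
proof (rule ccontr)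
  assume "\<nexists>t. 0 < \<epsilon> * u t"
  then have le: "\<epsilon> * u t \<le> 0" for t by (auto simp: not_less)
  have sg: "\<epsilon> * sgn (u t) \<le> 0" for t
    using le[of t] by (auto simp: mult_le_0_iff sgn_if split: if_splits)
  have summ: "summable (\<lambda>k. g (int k) * sgn (u (t - int k)))" for t
    by (rule summable_comparison_test'[OF causal_ell1_summable[OF ell1]])
      (simp add: abs_mult abs_sgn_eq less_imp_le[OF pos])
  have "0 \<le> \<epsilon> * u (t + int d)" for t
  proof -
    have "(\<Sum>k. \<epsilon> * (g (int k) * sgn (u (t - int k)))) \<le> (\<Sum>k. 0)"
    proof (rule suminf_le)
      fix k
      have "g (int k) * (\<epsilon> * sgn (u (t - int k))) \<le> 0"
        using pos[of k] sg by (simp add: mult_nonneg_nonpos)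
      then show "\<epsilon> * (g (int k) * sgn (u (t - int k))) \<le> 0" by (simp add: mult.left_commute)
    qed (simp_all add: summ summable_mult)
    then show ?thesis
      using relay_feedback_suminf[OF causal ell1, of d u t] osc
      by (simp add: self_oscillation_def suminf_mult summ)
  qed
  from this[of "_ - int d"] have "0 \<le> \<epsilon> * u t" for t by simp
  then have "\<epsilon> * u t = 0" for t using le[of t] by (intro order_antisym)
  then have "u t = 0" for t using \<open>\<epsilon> \<noteq> 0\<close> by simp
  then show False
    using osc cyclic_variation_diff_zero[of u P] by (simp add: self_oscillation_def periodic_def)
qed

lemma phase_normalized_shift_exists:
  assumes per: "periodic P u" and "u a < 0" "0 < u b"
  shows "\<exists>s. phase_normalized (time_shift s u)"
proof -
  define m where "m = b + \<bar>a - b\<bar> * int P"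
  have "\<bar>a - b\<bar> * 1 \<le> \<bar>a - b\<bar> * int P" using per by (intro mult_left_mono) (auto simp: periodic_def)
  then have "a \<le> m" by (simp add: m_def)
  have "0 < u m" using assms periodic_add_mult[OF per] by (simp add: m_def)
  then have "\<exists>n. 0 \<le> u (a + int n)" using \<open>a \<le> m\<close> by (intro exI[of _ "nat (m - a)"]) simp
  then obtain n where n: "0 \<le> u (a + int n)" "\<And>k. k < n \<Longrightarrow> \<not> 0 \<le> u (a + int k)"
    using exists_least_iff[of "\<lambda>n. 0 \<le> u (a + int n)"] by blast
  then have "0 < n" using \<open>u a < 0\<close> by (cases n) auto
  then have "u (a + int n - 1) < 0" using n(2)[of "n - 1"] by (simp add: of_nat_diff algebra_simps)
  then show ?thesis
    using n(1) by (intro exI[of _ "a + int n"]) (simp add: phase_normalized_def time_shift_def)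
qed

text \<open>Starting from any time \<open>m\<close> in the period with a positive value, \<open>q\<close> is the end of the run of
  positive values.
  Each forbidden value elsewhere in the period would complete a weak alternation together with
  times among \<open>0\<close>, \<open>m\<close>, \<open>q\<close> and \<open>P - 1\<close>.\<close>

lemma switching_time_exists:
  assumes per: "periodic P v" and not_alt: "\<not> weakly_alternating P v"
    and start: "v (-1) < 0" "0 \<le> v 0" and "0 < v b"
  obtains q where "0 < q" "q < int P" "\<And>t. 0 < t \<Longrightarrow> t < q \<Longrightarrow> 0 < v t" "0 < v (q - 1)" "v q \<le> 0"
    "\<And>t. q < t \<Longrightarrow> t < int P \<Longrightarrow> v t < 0"
proof -
  have alt: False if "x1 < x2" "x2 < x3" "x3 < x4" "x4 < x1 + int P"
    "0 \<le> v x1" "v x2 \<le> 0" "0 \<le> v x3" "v x4 \<le> 0" for x1 x2 x3 x4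
    using not_alt that unfolding weakly_alternating_def by blast
  have P: "0 < int P" using per by (simp add: periodic_def)
  have last: "v (int P - 1) < 0" using periodic_add_mult[OF per, of "-1" 1] start by simp
  define m where "m = b mod int P"
  have "b = m + (b div int P) * int P" by (simp add: m_def)
  then have vm: "0 < v m" using periodic_add_mult[OF per, of m "b div int P"] \<open>0 < v b\<close> by simp
  have "0 \<le> m" "m < int P" using P by (simp_all add: m_def)
  moreover from this have "m \<noteq> int P - 1" using vm last by auto
  ultimately have m: "0 \<le> m" "m < int P - 1" by auto
  have "\<exists>n. v (m + int n) \<le> 0"
    using last m by (intro exI[of _ "nat (int P - 1 - m)"]) simp
  then obtain n where n: "v (m + int n) \<le> 0" "\<And>k. k < n \<Longrightarrow> \<not> v (m + int k) \<le> 0"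
    using exists_least_iff[of "\<lambda>n. v (m + int n) \<le> 0"] by blast
  define q where "q = m + int n"
  have "n \<noteq> 0" using n(1) vm by (cases n) auto
  then have mq: "m < q" by (simp add: q_def)
  have run: "0 < v t" if "m \<le> t" "t < q" for t
    using n(2)[of "nat (t - m)"] that by (simp add: q_def nat_less_iff not_le)
  have qP: "q < int P"
    using run[of "int P - 1"] last m by (cases "q \<le> int P - 1") auto
  show thesis
  proof (rule that)
    show "0 < q" "q < int P" "v q \<le> 0" using mq m qP n(1) by (auto simp: q_def)
    show "0 < v (q - 1)" using run mq by simp
    show "0 < v t" if "0 < t" "t < q" for t
    proof (cases "m \<le> t")
      case False
      then show ?thesis
        using alt[of 0 t m "int P - 1"] that start vm last m by (auto simp: not_less[symmetric])
    qed (use run that in simp)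
    show "v t < 0" if "q < t" "t < int P" for t
      using alt[of m q t "int P - 1"] that mq m n(1) vm last
      by (cases "t = int P - 1") (auto simp: q_def not_less[symmetric])
  qed
qed

theorem theorem3:
  fixes g\<^sub>0 u :: "int \<Rightarrow> real" and P P\<^sub>d :: nat
  assumes "P\<^sub>d \<ge> 1"
    and "finite_dim_causal_impulse_response g\<^sub>0"
    and "in_ell1 g\<^sub>0"
    and "g\<^sub>0 0 > 0"
    and "{t. g\<^sub>0 t \<noteq> 0} = {0..}"
    and "strict_antimono_on {t. g\<^sub>0 t \<noteq> 0} g\<^sub>0"
    and "self_oscillation g\<^sub>0 P\<^sub>d P u"
    and "P \<ge> P\<^sub>d"
    and "cyclic_variation (cyclic_diff (period_vec P u)) = 2"
    and "max_cyclic_variation (period_vec P u) = 2"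
  shows "2 * P\<^sub>d \<le> P \<and> P \<le> 2 * (P\<^sub>d + settling_index g\<^sub>0) \<and>
    (\<exists>s. phase_normalized (time_shift s u)) \<and>
    (\<forall>s v. v = time_shift s u \<and> phase_normalized v \<longrightarrow>
      (P = 2 * P\<^sub>d \<longleftrightarrow> convolution g\<^sub>0 (sign_seq v) 0 > 0) \<and>
      (P = 2 * P\<^sub>d \<longleftrightarrow>
         convolution g\<^sub>0 (sign_seq v) 0 > 0 \<and>
         period_vec P (sign_seq v) = period_vec (2 * P\<^sub>d) (sign_seq v) \<and>
         period_vec (2 * P\<^sub>d) (sign_seq v) = replicate P\<^sub>d 1 @ replicate P\<^sub>d (-1)))"
proof -
  note ell1 = assms(3) and osc = assms(7)
  have causal: "g\<^sub>0 t = 0" if "t < 0" for t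
  proof -
    have "t \<notin> {t. g\<^sub>0 t \<noteq> 0}" using that by (simp add: assms(5))
    then show ?thesis by simp
  qed
  have dec: "g\<^sub>0 (int j) < g\<^sub>0 (int i)" if "i < j" for i j
    using assms(5,6) that by (auto simp: monotone_on_def)
  have summ: "summable (\<lambda>k. g\<^sub>0 (int k))" by (rule causal_ell1_summable[OF ell1])
  have pos: "0 < g\<^sub>0 (int k)" for k
  proof -
    have "g\<^sub>0 (int (Suc k)) < g\<^sub>0 (int k)" by (rule dec) simp
    moreover have "0 \<le> g\<^sub>0 (int (Suc k))"
    proof (rule LIMSEQ_le_const2[OF summable_LIMSEQ_zero[OF summ]])
      show "\<exists>N. \<forall>n\<ge>N. g\<^sub>0 (int n) \<le> g\<^sub>0 (int (Suc k))"
        using dec by (metis le_less less_le_not_le linear)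
    qed
    ultimately show ?thesis by simp
  qed
  have per: "periodic P u" and fb: "relay_feedback g\<^sub>0 P\<^sub>d u"
    using osc by (simp_all add: self_oscillation_def)
  obtain a b where ab: "u a < 0" "0 < u b"
    using oscillation_changes_sign[OF causal ell1 pos osc, of "-1"]
      oscillation_changes_sign[OF causal ell1 pos osc, of 1] by auto
  have not_alt: "\<not> weakly_alternating P u"
    using not_weakly_alternating[OF per] assms(10) by simp
  have cycle: "\<exists>q. relay_cycle P P\<^sub>d q (\<lambda>k. g\<^sub>0 (int k)) (time_shift s u)"
    if norm: "phase_normalized (time_shift s u)" for s
  proof -
    let ?v = "time_shift s u"
    have per_v: "periodic P ?v"
      using per by (auto simp: periodic_def time_shift_def algebra_simps) (metis add.assoc)
    have "\<not> weakly_alternating P ?v"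
    proof
      assume "weakly_alternating P ?v"
      then obtain a b c d where "a < b \<and> b < c \<and> c < d \<and> d < a + int P \<and>
          0 \<le> ?v a \<and> ?v b \<le> 0 \<and> 0 \<le> ?v c \<and> ?v d \<le> 0"
        unfolding weakly_alternating_def by blast
      then have "weakly_alternating P u"
        unfolding weakly_alternating_def time_shift_def
        by (intro exI[of _ "a + s"] exI[of _ "b + s"] exI[of _ "c + s"] exI[of _ "d + s"]) auto
      with not_alt show False by simp
    qed
    moreover have "0 < ?v (b - s)" using ab by (simp add: time_shift_def)
    ultimately obtain q where "0 < q" "q < int P" "\<And>t. 0 < t \<Longrightarrow> t < q \<Longrightarrow> 0 < ?v t"
        "0 < ?v (q - 1)" "?v q \<le> 0" "\<And>t. q < t \<Longrightarrow> t < int P \<Longrightarrow> ?v t < 0"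
      using switching_time_exists[OF per_v, of "b - s"] norm unfolding phase_normalized_def by metis
    then have "relay_cycle P P\<^sub>d q (\<lambda>k. g\<^sub>0 (int k)) ?v"
      using relay_feedback_suminf[OF causal ell1 fb, of "_ + s"] per_v norm assms(1,8)
      by unfold_locales
        (auto simp: pos dec summ phase_normalized_def time_shift_def algebra_simps)
    then show ?thesis ..
  qed
  have bounds: "2 * P\<^sub>d \<le> P \<and> P \<le> 2 * (P\<^sub>d + settling_index g\<^sub>0)" and
    shift: "\<exists>s. phase_normalized (time_shift s u)"
  proof -
    show shift: "\<exists>s. phase_normalized (time_shift s u)"
      by (rule phase_normalized_shift_exists[OF per ab])
    then obtain s q where "relay_cycle P P\<^sub>d q (\<lambda>k. g\<^sub>0 (int k)) (time_shift s u)"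
      using cycle by blast
    then interpret relay_cycle P P\<^sub>d q "\<lambda>k. g\<^sub>0 (int k)" "time_shift s u" .
    show "2 * P\<^sub>d \<le> P \<and> P \<le> 2 * (P\<^sub>d + settling_index g\<^sub>0)"
      using delay_le_half period_le[OF settling_index_tail_less[OF pos summ]] by simp
  qed
  have iff: "P = 2 * P\<^sub>d \<longleftrightarrow> 0 < convolution g\<^sub>0 (sign_seq v) 0"
    and pattern: "P = 2 * P\<^sub>d \<Longrightarrow>
      period_vec (2 * P\<^sub>d) (sign_seq v) = replicate P\<^sub>d 1 @ replicate P\<^sub>d (-1)"
    if v: "v = time_shift s u" "phase_normalized v" for s v
  proof -
    obtain q where "relay_cycle P P\<^sub>d q (\<lambda>k. g\<^sub>0 (int k)) v" using cycle v by blast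
    then interpret relay_cycle P P\<^sub>d q "\<lambda>k. g\<^sub>0 (int k)" v .
    have "convolution g\<^sub>0 (sign_seq v) 0 = (\<Sum>k. g\<^sub>0 (int k) * sgn (v (0 - int k)))"
      using convolution_eq_suminf[OF causal ell1, of "sign_seq v" 0]
      by (simp add: sign_seq_def abs_sgn_eq)
    also have "\<dots> = response 0" using feedback[of 0] feedback_folded[of 0] by simp
    finally show "P = 2 * P\<^sub>d \<longleftrightarrow> 0 < convolution g\<^sub>0 (sign_seq v) 0"
      using period_eq_half_iff by simp
    assume P: "P = 2 * P\<^sub>d"
    note sw = half_period_strict_switches[OF P]
    show "period_vec (2 * P\<^sub>d) (sign_seq v) = replicate P\<^sub>d 1 @ replicate P\<^sub>d (-1)"
    proof (rule nth_equalityI)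
      fix i assume "i < length (period_vec (2 * P\<^sub>d) (sign_seq v))"
      then have i: "i < 2 * P\<^sub>d" by (simp add: period_vec_def)
      show "period_vec (2 * P\<^sub>d) (sign_seq v) ! i = (replicate P\<^sub>d 1 @ replicate P\<^sub>d (-1)) ! i"
      proof (cases "i < P\<^sub>d")
        case True
        then have "0 < v (int i)" using sw plus[of "int i"] by (cases "i = 0") auto
        then show ?thesis using True i by (simp add: period_vec_def sign_seq_def nth_append)
      next
        case False
        then have "v (int i) < 0" using sw minus[of "int i"] i P by (cases "i = P\<^sub>d") auto
        then show ?thesis using False i by (simp add: period_vec_def sign_seq_def nth_append)
      qed
    qed (simp add: period_vec_def)
  qed
  show ?thesis using bounds shift iff pattern by metis
qed

end
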